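(* Let $R\subseteq\mathbb{R}$, let $f^*:\mathbb{R}\to R$ be bijective with inverse function $f^{*(-1)}$, and let $F^*$ be an antiderivative of $f^*$. For $f_0,f_1\in R$ define $$q_1(f_0,f_1)=\frac{F^*(f^{*(-1)}(f_1))-F^*(f^{*(-1)}(f_0))}{f^{*(-1)}(f_1)-f^{*(-1)}(f_0)},$$ where for $f_0=f_1$ the value is understood as the limit $\lim_{y\to f_0}q_1(f_0,y)$. Then the two-point quadrature formula $$\hat I_1[f]=h\,q_1(f(a),f(a+h))$$ (nodes $\xi_0=0$, $\xi_1=1$) is symmetric and affinely exact on $f^*$. Moreover, with $$q_2(f_0,f_1,f_2)=\tfrac{2}{3}\bigl(q_1(f_0,f_1)+q_1(f_1,f_2)\bigr)-\tfrac13 q_1(f_0,f_2),$$ the three-point quadrature formula with nodes $\xi_0=0$, $\xi_1=\tfrac12$, $\xi_2=1$ given by $$\hat I_2[f]=h\,q_2\bigl(f(a),f(a+\tfrac h2),f(a+h)\bigr)$$ is symmetric and affinely exact on $f^*$, and for every $f\in C^4(\mathbb{R})$ with values in $R$ it satisfies $$\left|\hat I_2[f]-\int_a^{a+h}f(x)\,dx\right|\le\frac{h^5}{2880}\sup_{\xi\in[a,a+h]}\left|f^{(4)}(\xi)-\Omega_f\right|,$$ where $$\begin{aligned}\Omega_f=\frac{480}{h^4}\Bigl(&f(a)+4f(a+\tfrac h2)+f(a+h)+2q_1(f(a),f(a+h))\\&-4\bigl(q_1(f(a),f(a+\tfrac h2))+q_1(f(a+\tfrac h2),f(a+h))\bigr)\Bigr).\end{aligned}$$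 If $q_1$ is four times continuously differentiable on $R\times R$, then for each such $f$ and each fixed $a$, $\Omega_f$ remains bounded as $h\to0^+$.
   Context: Here $a\in\mathbb{R}$ and $h>0$ are arbitrary. For a quadrature formula $\hat I[f]=h\,q(f(a+\xi_0h),\ldots,f(a+\xi_{n-1}h))$: - $\hat I$ is affinely exact on $f^*$ if, with $f^*_{\alpha,\beta}(x)=f^*(\alpha x+\beta)$, one has $\hat I[f^*_{\alpha,\beta}]=\int_a^{a+h}f^*_{\alpha,\beta}(x)\,dx$ for all $\alpha,\beta\in\mathbb{R}$ and all $h>0$. - $\hat I$ is symmetric if $\xi_{n-1-k}=1-\xi_k$ for all $k\in\{0,\ldots,n-1\}$ and $q(f_{n-1},\ldots,f_0)=q(f_0,\ldots,f_{n-1})$ for all arguments in the domain of $q$ (here $R^n$). An antiderivative of $f^*$ is a differentiable function $F^*$ with $F^{*\prime}=f^*$. *)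

theory Defs
  imports "HOL-Analysis.Analysis"
begin

text \<open>
  A quadrature formula with \<open>n\<close> nodes is given by the list \<open>xs\<close> of its nodes \<open>\<xi>\<^sub>0, \<dots>, \<xi>\<^bsub>n-1\<^esub>\<close>
  (relative to the interval \<open>[0, 1]\<close>) and a function \<open>q\<close>, whose arguments from \<open>R\<^sup>n\<close> are the
  lists of length \<open>n\<close> with entries in \<open>R\<close>.
\<close>

definition quadrature ::
    "real list \<Rightarrow> (real list \<Rightarrow> real) \<Rightarrow> real \<Rightarrow> real \<Rightarrow> (real \<Rightarrow> real) \<Rightarrow> real" where
  "quadrature xs q a h f = h * q (map (\<lambda>\<xi>. f (a + \<xi> * h)) xs)"

definition symmetric_quadrature :: "real set \<Rightarrow> real list \<Rightarrow> (real list \<Rightarrow> real) \<Rightarrow> bool" where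
  "symmetric_quadrature R xs q \<longleftrightarrow>
     (\<forall>k<length xs. xs ! (length xs - 1 - k) = 1 - xs ! k) \<and>
     (\<forall>v. length v = length xs \<and> set v \<subseteq> R \<longrightarrow> q (rev v) = q v)"

definition affinely_exact :: "real list \<Rightarrow> (real list \<Rightarrow> real) \<Rightarrow> (real \<Rightarrow> real) \<Rightarrow> bool" where
  "affinely_exact xs q fs \<longleftrightarrow>
     (\<forall>\<alpha> \<beta> a h. h > 0 \<longrightarrow>
        ((\<lambda>x. fs (\<alpha> * x + \<beta>)) has_integral quadrature xs q a h (\<lambda>x. fs (\<alpha> * x + \<beta>))) {a..a + h})"

text \<open>
  \<open>fs\<close> is the function on which the rules are to be exact, with range \<open>R\<close>, and \<open>Fs\<close> is an
  antiderivative of it. The filter \<open>at f0 within R\<close> excludes \<open>f0\<close> itself, so the limit in the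
  diagonal case only involves the off-diagonal difference quotients.
\<close>

definition q1 :: "real set \<Rightarrow> (real \<Rightarrow> real) \<Rightarrow> (real \<Rightarrow> real) \<Rightarrow> real \<Rightarrow> real \<Rightarrow> real" where
  "q1 R fs Fs f0 f1 =
     (if f0 = f1
      then Lim (at f0 within R) (\<lambda>y. (Fs (inv fs y) - Fs (inv fs f0)) / (inv fs y - inv fs f0))
      else (Fs (inv fs f1) - Fs (inv fs f0)) / (inv fs f1 - inv fs f0))"

definition q2 :: "real set \<Rightarrow> (real \<Rightarrow> real) \<Rightarrow> (real \<Rightarrow> real) \<Rightarrow> real \<Rightarrow> real \<Rightarrow> real \<Rightarrow> real" where
  "q2 R fs Fs f0 f1 f2 =
     2 / 3 * (q1 R fs Fs f0 f1 + q1 R fs Fs f1 f2) - 1 / 3 * q1 R fs Fs f0 f2"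

abbreviation I1 :: "real set \<Rightarrow> (real \<Rightarrow> real) \<Rightarrow> (real \<Rightarrow> real) \<Rightarrow> real \<Rightarrow> real \<Rightarrow> (real \<Rightarrow> real) \<Rightarrow> real" where
  "I1 R fs Fs \<equiv> quadrature [0, 1] (\<lambda>v. q1 R fs Fs (v ! 0) (v ! 1))"

abbreviation I2 :: "real set \<Rightarrow> (real \<Rightarrow> real) \<Rightarrow> (real \<Rightarrow> real) \<Rightarrow> real \<Rightarrow> real \<Rightarrow> (real \<Rightarrow> real) \<Rightarrow> real" where
  "I2 R fs Fs \<equiv> quadrature [0, 1 / 2, 1] (\<lambda>v. q2 R fs Fs (v ! 0) (v ! 1) (v ! 2))"

lemma I1_eq: "I1 R fs Fs a h f = h * q1 R fs Fs (f a) (f (a + h))"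
  by (simp add: quadrature_def)

lemma I2_eq: "I2 R fs Fs a h f = h * q2 R fs Fs (f a) (f (a + h / 2)) (f (a + h))"
  by (simp add: quadrature_def numeral_2_eq_2)

definition Omega ::
    "real set \<Rightarrow> (real \<Rightarrow> real) \<Rightarrow> (real \<Rightarrow> real) \<Rightarrow> real \<Rightarrow> real \<Rightarrow> (real \<Rightarrow> real) \<Rightarrow> real" where
  "Omega R fs Fs a h f =
     480 / h ^ 4 *
     (f a + 4 * f (a + h / 2) + f (a + h) + 2 * q1 R fs Fs (f a) (f (a + h))
      - 4 * (q1 R fs Fs (f a) (f (a + h / 2)) + q1 R fs Fs (f (a + h / 2)) (f (a + h))))"

text \<open>
  \<open>k\<close> times continuously differentiable on an open set \<open>S\<close> (of a finite-dimensional space): all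
  iterated directional derivatives of order up to \<open>k\<close> exist and are continuous.
\<close>

fun Ck_on :: "nat \<Rightarrow> ('a::real_normed_vector \<Rightarrow> 'b::real_normed_vector) \<Rightarrow> 'a set \<Rightarrow> bool" where
  "Ck_on 0 g S \<longleftrightarrow> continuous_on S g"
| "Ck_on (Suc k) g S \<longleftrightarrow>
     (\<forall>x\<in>S. g differentiable (at x)) \<and>
     (\<forall>v. Ck_on k (\<lambda>x. frechet_derivative g (at x) v) S)"

end

theory Submission
  imports Defs "HOL-Library.Landau_Symbols"
begin

text \<open>
  A derivative has the intermediate value property, so the injective derivative \<open>fs\<close> is an open map:
  \<open>R\<close> is open and \<open>inv fs\<close> is continuous on it. The difference quotient in \<open>q1\<close> then tends to
  \<open>Fs' (inv fs u) = u\<close> on the diagonal (\<open>q1_diagonal\<close>), so that \<open>q1\<close> is a symmetric mean: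
  \<open>q1 u v = q1 v u\<close> and \<open>q1 u u = u\<close>. On affine images of \<open>fs\<close>, \<open>I1\<close> is the fundamental theorem of
  calculus after a linear substitution. The rule \<open>I2\<close> applies \<open>I1\<close> to the two halves of the interval
  with weight \<open>4 / 3\<close> and to the whole interval with weight \<open>- 1 / 3\<close>; the weights add up to one, so
  exactness is inherited.

  For the error bound, the definition of \<open>Omega\<close> says that \<open>I2\<close> is Simpson's rule minus
  \<open>h ^ 5 / 2880 * Omega\<close> (\<open>I2_as_corrected_simpson\<close>), while the integral is Simpson's rule minus
  \<open>h ^ 5 / 2880\<close> times a value of the fourth derivative (\<open>simpson_error\<close>). The two corrections are
  subtracted.

  For the boundedness of \<open>Omega\<close>, Taylor's theorem gives a cubic polynomial that approximates
  \<open>q1 (u + s) (u + t)\<close> up to fourth order. Symmetry and \<open>q1 x x = x\<close> leave two of its coefficients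
  undetermined: the expansion is
  \<open>u + (s + t) / 2 + (s - t)\<^sup>2 * (A + B * (s + t))\<close> (\<open>symmetric_mean_expansion\<close>). Inserting the
  increments \<open>0\<close>, \<open>s1\<close>, \<open>s2\<close> of \<open>f\<close> at \<open>a\<close>, \<open>a + h / 2\<close>, \<open>a + h\<close> into the combination of values in
  \<open>Omega\<close>, the linear terms cancel and every other term of the polynomial contains the second
  difference \<open>d = s2 - 2 * s1\<close>, which is of order \<open>h\<^sup>2\<close>: what remains are multiples of \<open>d\<^sup>2\<close>,
  \<open>d * s1\<^sup>2\<close> and terms of higher order. Hence the combination is of order \<open>h ^ 4\<close> (\<open>mean_defect_bigo\<close>), which the factor \<open>480 / h ^ 4\<close> compensates.
\<close>

section \<open>Injective derivatives\<close>

text \<open>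
  Darboux's theorem: if \<open>f a < c < f b\<close>, then \<open>F x - c * x\<close> attains its minimum over \<open>{a..b}\<close> in the
  interior, because it decreases to the right of \<open>a\<close> and increases up to \<open>b\<close>. The other case is this
  one for \<open>- F\<close>.
\<close>

lemma derivative_intermediate_value:
  fixes F f :: "real \<Rightarrow> real"
  assumes der: "\<And>x. (F has_real_derivative f x) (at x)"
    and "a < b" and c: "f a < c \<and> c < f b \<or> f b < c \<and> c < f a"
  obtains x where "a < x" "x < b" "f x = c"
proof -
  have up: "\<exists>x. a < x \<and> x < b \<and> g x = d"
    if G: "\<And>x. (G has_real_derivative g x) (at x)" and d: "g a < d" "d < g b" for G g d
  proof -
    define H where "H = (\<lambda>x. G x - d * x)"
    have H: "(H has_real_derivative g x - d) (at x)" for x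
      unfolding H_def by (auto intro!: derivative_eq_intros G)
    have "continuous_on {a..b} H"
      by (meson H DERIV_isCont continuous_at_imp_continuous_on)
    then obtain x where x: "x \<in> {a..b}" "\<And>y. y \<in> {a..b} \<Longrightarrow> H x \<le> H y"
      using continuous_attains_inf[of "{a..b}" H] \<open>a < b\<close> by force
    obtain e where e: "e > 0" "\<And>s. s > 0 \<Longrightarrow> s < e \<Longrightarrow> H (a + s) < H a"
      using DERIV_neg_dec_right[OF H[of a]] d by auto
    obtain e' where e': "e' > 0" "\<And>s. s > 0 \<Longrightarrow> s < e' \<Longrightarrow> H (b - s) < H b"
      using DERIV_pos_inc_left[OF H[of b]] d by auto
    define s where "s = min (min e e') (b - a) / 2"
    have s: "s > 0" "s < e" "s < e'" "s < b - a"
      using e(1) e'(1) \<open>a < b\<close> by (auto simp: s_def min_def field_simps)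
    have "x \<noteq> a" using e(2)[OF s(1,2)] x(2)[of "a + s"] s by auto
    moreover have "x \<noteq> b" using e'(2)[OF s(1,3)] x(2)[of "b - s"] s by auto
    ultimately have xi: "a < x" "x < b" using x(1) by auto
    have "g x - d = 0"
    proof (rule DERIV_local_min[OF H])
      show "0 < min (x - a) (b - x)" using xi by simp
      show "\<forall>y. \<bar>x - y\<bar> < min (x - a) (b - x) \<longrightarrow> H x \<le> H y"
        using x(2) by (auto simp: abs_if split: if_splits)
    qed
    then show ?thesis using xi by auto
  qed
  have "\<exists>x. a < x \<and> x < b \<and> f x = c"
    using c
  proof
    assume "f b < c \<and> c < f a"
    then show ?thesis
      using up[of "\<lambda>x. - F x" "\<lambda>x. - f x" "- c"] DERIV_minus[OF der] by auto
  qed (use up[OF der] in auto)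
  then show ?thesis using that by blast
qed

text \<open>
  By injectivity and the intermediate value property, the value at an inner point of an interval lies
  strictly between the values at the ends, and everything between the end values is attained inside.
\<close>

lemma injective_derivative_open_map:
  fixes F f :: "real \<Rightarrow> real"
  assumes der: "\<And>x. (F has_real_derivative f x) (at x)" and "inj f" and "open S"
  shows "open (f ` S)"
proof (rule topological_space_class.openI)
  fix w assume "w \<in> f ` S"
  then obtain x where x: "x \<in> S" "w = f x" by auto
  obtain e where e: "e > 0" "\<And>y. \<bar>y - x\<bar> < e \<Longrightarrow> y \<in> S"
    using \<open>open S\<close> x by (auto simp: open_dist dist_real_def)
  define a b where "a = x - e" and "b = x + e"
  have ab: "a < x" "x < b" "{a<..<b} \<subseteq> S"
    using e unfolding a_def b_def by (auto simp: abs_less_iff)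
  have neq: "f a \<noteq> f x" "f b \<noteq> f x" "f a \<noteq> f b"
    using ab injD[OF \<open>inj f\<close>] by force+
  have no: "\<not> (f u < f v \<and> f v < f w \<or> f w < f v \<and> f v < f u)"
    if "v < min u w \<or> max u w < v" for u v w
  proof
    assume H: "f u < f v \<and> f v < f w \<or> f w < f v \<and> f v < f u"
    have "\<exists>z. min u w < z \<and> z < max u w \<and> f z = f v"
    proof (rule linorder_cases[of u w])
      assume less: "u < w"
      then obtain z where "u < z" "z < w" "f z = f v"
        using derivative_intermediate_value[OF der less H] by blast
      then show ?thesis using less by (intro exI[of _ z]) simp
    next
      assume greater: "w < u"
      moreover obtain z where "w < z" "z < u" "f z = f v"
        using derivative_intermediate_value[OF der greater, of "f v"] H by blast
      ultimately show ?thesis by (intro exI[of _ z]) simp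
    qed (use H in auto)
    then obtain z where z: "min u w < z" "z < max u w" "f z = f v" by blast
    then show False using injD[OF \<open>inj f\<close> z(3)] that by auto
  qed
  \<comment> \<open>\<open>f x\<close> lies between \<open>f a\<close> and \<open>f b\<close>: otherwise one end value would be taken a second time.\<close>
  have na: "\<not> (f x < f a \<and> f a < f b \<or> f b < f a \<and> f a < f x)"
    by (rule no[of a x b]) (use ab in simp)
  have nb: "\<not> (f x < f b \<and> f b < f a \<or> f a < f b \<and> f b < f x)"
    by (rule no[of b x a]) (use ab in simp)
  have btw: "min (f a) (f b) < f x" "f x < max (f a) (f b)"
    using na nb neq by linarith+
  have sub: "{min (f a) (f b)<..<max (f a) (f b)} \<subseteq> f ` S"
  proof
    fix c assume c: "c \<in> {min (f a) (f b)<..<max (f a) (f b)}"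
    then have "f a < c \<and> c < f b \<or> f b < c \<and> c < f a" by auto
    then obtain z where "a < z" "z < b" "f z = c"
      using derivative_intermediate_value[OF der, of a b c] ab by auto
    then show "c \<in> f ` S" using ab(3) by auto
  qed
  show "\<exists>T. open T \<and> w \<in> T \<and> T \<subseteq> f ` S"
    using btw sub x(2) by (intro exI[of _ "{min (f a) (f b)<..<max (f a) (f b)}"]) auto
qed

lemma bijective_derivative_inverse:
  fixes F f :: "real \<Rightarrow> real"
  assumes bij: "bij_betw f UNIV R" and der: "\<And>x. (F has_real_derivative f x) (at x)"
  shows "open R" and "continuous_on R (inv f)"
proof -
  have inj: "inj f" using bij by (rule bij_betw_imp_inj_on)
  have R: "range f = R" using bij by (rule bij_betw_imp_surj_on)
  have op: "open (f ` S)" if "open S" for S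
    using der inj that by (rule injective_derivative_open_map)
  show oR: "open R" using op[OF open_UNIV] unfolding R .
  have "open (inv f -` B \<inter> R)" if "open B" for B
  proof -
    have "inv f -` B \<inter> R = f ` B"
      unfolding R[symmetric] by (auto simp: inv_f_f[OF inj])
    then show ?thesis
      using op[OF that] by argo
  qed
  then show "continuous_on R (inv f)"
    using continuous_on_open_vimage[OF oR, of "inv f"] by blast
qed

section \<open>The mean \<open>q1\<close> and the exactness of the two rules\<close>

text \<open>
  The substitution \<open>x = inv fs y\<close> turns the quotient into the difference quotient of \<open>Fs\<close> at
  \<open>inv fs u\<close>, whose derivative there is \<open>u\<close>.
\<close>

lemma q1_diagonal:
  fixes fs Fs :: "real \<Rightarrow> real" and u :: real
  assumes bij: "bij_betw fs UNIV R"
    and der: "\<And>x. (Fs has_real_derivative fs x) (at x)" and u: "u \<in> R"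
  shows "q1 R fs Fs u u = u"
    and "((\<lambda>y. q1 R fs Fs u y) \<longlongrightarrow> u) (at u within R)"
proof -
  define g where "g = inv fs"
  define Q where "Q = (\<lambda>y. (Fs (g y) - Fs (g u)) / (g y - g u))"
  have fg: "fs (g y) = y" if "y \<in> R" for y
    unfolding g_def using bij that by (rule bij_betw_inv_into_right)
  have "open R"
    using bij der by (rule bijective_derivative_inverse(1))
  have cont: "continuous_on R g"
    unfolding g_def using bij der by (rule bijective_derivative_inverse(2))
  have "(g \<longlongrightarrow> g u) (at u within R)"
    using cont u by (simp add: continuous_on_def)
  moreover have "g y \<noteq> g u" if "y \<in> R" "y \<noteq> u" for y
    using fg[OF that(1)] fg[OF u] that(2) by auto
  then have "\<forall>\<^sub>F y in at u within R. g y \<noteq> g u"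
    unfolding eventually_at_filter by (intro always_eventually) blast
  ultimately have "filterlim g (at (g u)) (at u within R)"
    by (simp add: filterlim_at)
  moreover have "((\<lambda>x. (Fs x - Fs (g u)) / (x - g u)) \<longlongrightarrow> u) (at (g u))"
    using der[of "g u"] unfolding has_field_derivative_iff fg[OF u] .
  ultimately have lim: "(Q \<longlongrightarrow> u) (at u within R)"
    unfolding Q_def by (rule filterlim_compose[rotated])
  have "at u within R \<noteq> bot"
    unfolding at_within_open[OF u \<open>open R\<close>] by simp
  then have "Lim (at u within R) Q = u"
    using lim by (rule tendsto_Lim)
  then show "q1 R fs Fs u u = u"
    by (simp add: q1_def Q_def g_def)
  have "q1 R fs Fs u y = Q y" if "y \<noteq> u" for y
    using that by (simp add: q1_def Q_def g_def)
  then have "\<forall>\<^sub>F y in at u within R. q1 R fs Fs u y = Q y"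
    unfolding eventually_at_filter by (intro always_eventually) blast
  then show "((\<lambda>y. q1 R fs Fs u y) \<longlongrightarrow> u) (at u within R)"
    using lim by (rule tendsto_cong[THEN iffD2])
qed

lemma q1_commute: "q1 R fs Fs u v = q1 R fs Fs v u"
proof (cases "u = v")
  case False
  then show ?thesis
    unfolding q1_def
    using minus_divide_divide[of "Fs (inv fs v) - Fs (inv fs u)" "inv fs v - inv fs u"] by simp
qed simp

text \<open>
  The case \<open>\<alpha> = 0\<close> is where the diagonal value of \<open>q1\<close> enters: the integrand is constant.
\<close>

lemma I1_affinely_exact:
  fixes fs Fs :: "real \<Rightarrow> real" and \<alpha> \<beta> a h :: real
  assumes bij: "bij_betw fs UNIV R"
    and der: "\<And>x. (Fs has_real_derivative fs x) (at x)" and "h > 0"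
  shows "((\<lambda>x. fs (\<alpha> * x + \<beta>)) has_integral I1 R fs Fs a h (\<lambda>x. fs (\<alpha> * x + \<beta>))) {a..a + h}"
proof (cases "\<alpha> = 0")
  case True
  have "fs \<beta> \<in> R" using bij by (auto simp: bij_betw_def)
  then have "I1 R fs Fs a h (\<lambda>x. fs (\<alpha> * x + \<beta>)) = h * fs \<beta>"
    unfolding I1_eq using q1_diagonal(1)[OF bij der] True by simp
  then show ?thesis
    using True has_integral_const_real[of "fs \<beta>" a "a + h"] \<open>h > 0\<close> by simp
next
  case False
  define P where "P = (\<lambda>x. Fs (\<alpha> * x + \<beta>) / \<alpha>)"
  have "inj fs" using bij by (simp add: bij_betw_def)
  then have "fs (\<alpha> * a + \<beta>) \<noteq> fs (\<alpha> * (a + h) + \<beta>)"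
    using False \<open>h > 0\<close> by (auto dest!: injD)
  then have I: "I1 R fs Fs a h (\<lambda>x. fs (\<alpha> * x + \<beta>)) = P (a + h) - P a"
    unfolding I1_eq using False \<open>h > 0\<close> \<open>inj fs\<close> by (simp add: q1_def P_def field_simps)
  have "((\<lambda>x. fs (\<alpha> * x + \<beta>)) has_integral P (a + h) - P a) {a..a + h}"
  proof (rule fundamental_theorem_of_calculus)
    fix x
    have "(P has_real_derivative fs (\<alpha> * x + \<beta>)) (at x)"
      unfolding P_def using False
      by (auto intro!: derivative_eq_intros DERIV_chain2[OF der])
    then show "(P has_vector_derivative fs (\<alpha> * x + \<beta>)) (at x within {a..a + h})"
      using has_field_derivative_at_within has_real_derivative_iff_has_vector_derivative by blast
  qed (use \<open>h > 0\<close> in simp)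
  then show ?thesis using I by simp
qed

lemma I2_eq_I1:
  "I2 R fs Fs a h f =
     4 / 3 * (I1 R fs Fs a (h / 2) f + I1 R fs Fs (a + h / 2) (h / 2) f) - 1 / 3 * I1 R fs Fs a h f"
  unfolding I1_eq I2_eq unfolding q2_def by (simp add: algebra_simps)

lemma I2_affinely_exact:
  fixes fs Fs :: "real \<Rightarrow> real" and \<alpha> \<beta> a h :: real
  assumes bij: "bij_betw fs UNIV R"
    and der: "\<And>x. (Fs has_real_derivative fs x) (at x)" and "h > 0"
  shows "((\<lambda>x. fs (\<alpha> * x + \<beta>)) has_integral I2 R fs Fs a h (\<lambda>x. fs (\<alpha> * x + \<beta>))) {a..a + h}"
proof -
  let ?f = "\<lambda>x. fs (\<alpha> * x + \<beta>)"
  note exact = I1_affinely_exact[OF bij der, of _ \<alpha> \<beta>]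
  have "(?f has_integral I1 R fs Fs a (h / 2) ?f + I1 R fs Fs (a + h / 2) (h / 2) ?f) {a..a + h}"
    using has_integral_combine[OF _ _ exact[of "h / 2" a] exact[of "h / 2" "a + h / 2"]] \<open>h > 0\<close>
    by (simp add: add.assoc)
  moreover from this have "I1 R fs Fs a (h / 2) ?f + I1 R fs Fs (a + h / 2) (h / 2) ?f = I1 R fs Fs a h ?f"
    using exact[OF \<open>h > 0\<close>] has_integral_unique by blast
  ultimately show ?thesis
    using exact[OF \<open>h > 0\<close>, of a] unfolding I2_eq_I1 by simp
qed

section \<open>The error of Simpson's rule\<close>

text \<open>
  With the midpoint \<open>m\<close> and the half length \<open>k\<close>, consider the error of Simpson's rule on
  \<open>{m - t..m + t}\<close> minus \<open>C * t ^ 5\<close>, where \<open>C\<close> makes the difference vanish at \<open>t = k\<close>. It also vanishes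
  to third order at \<open>0\<close>, so its third derivative has a zero in between. That derivative only involves
  the difference of the third derivatives at \<open>m + t\<close> and \<open>m - t\<close>, so the mean value theorem expresses
  \<open>C\<close> by a value of the fourth derivative.
\<close>

lemma simpson_error:
  fixes D :: "nat \<Rightarrow> real \<Rightarrow> real"
  assumes der: "\<And>n x. n < 4 \<Longrightarrow> (D n has_real_derivative D (Suc n) x) (at x)" and "h > 0"
  obtains \<xi> where "\<xi> \<in> {a..a + h}"
    "integral {a..a + h} (D 0) = h / 6 * (D 0 a + 4 * D 0 (a + h / 2) + D 0 (a + h)) - h ^ 5 / 2880 * D 4 \<xi>"
proof -
  have D: "(D 0 has_real_derivative D 1 x) (at x)" "(D 1 has_real_derivative D 2 x) (at x)"
    "(D 2 has_real_derivative D 3 x) (at x)" "(D 3 has_real_derivative D 4 x) (at x)" for x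
    using der[of 0 x] der[of 1 x] der[of 2 x] der[of 3 x] by (simp_all add: eval_nat_numeral)
  define k m where "k = h / 2" and "m = a + h / 2"
  have k: "k > 0" "h = 2 * k" "m - k = a" "m + k = a + h" using \<open>h > 0\<close> by (auto simp: k_def m_def)
  have "continuous_on {a - 1..a + h + 1} (D 0)"
    by (meson D(1) DERIV_isCont continuous_at_imp_continuous_on)
  then obtain F where F0: "\<And>x. x \<in> {a - 1..a + h + 1} \<Longrightarrow>
      (F has_vector_derivative D 0 x) (at x within {a - 1..a + h + 1})"
    using antiderivative_continuous by blast
  have F: "(F has_real_derivative D 0 x) (at x)" if "a \<le> x" "x \<le> a + h" for x
    using F0[of x] that at_within_interior[of x "{a - 1..a + h + 1}"]
    by (simp add: has_real_derivative_iff_has_vector_derivative)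
  have int: "integral {a..a + h} (D 0) = F (a + h) - F a"
  proof (rule integral_unique, rule fundamental_theorem_of_calculus)
    show "(F has_vector_derivative D 0 x) (at x within {a..a + h})" if "x \<in> {a..a + h}" for x
      using F[of x] that has_field_derivative_at_within has_real_derivative_iff_has_vector_derivative
      by fastforce
  qed (use \<open>h > 0\<close> in simp)
  define C where "C = (F (m + k) - F (m - k) - k / 3 * (D 0 (m - k) + 4 * D 0 m + D 0 (m + k))) / k ^ 5"
  define P0 where "P0 = (\<lambda>t. F (m + t) - F (m - t) - t / 3 * (D 0 (m - t) + 4 * D 0 m + D 0 (m + t)) - C * t ^ 5)"
  define P1 where "P1 = (\<lambda>t. D 0 (m + t) + D 0 (m - t) - (D 0 (m - t) + 4 * D 0 m + D 0 (m + t)) / 3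
      - t / 3 * (D 1 (m + t) - D 1 (m - t)) - 5 * C * t ^ 4)"
  define P2 where "P2 = (\<lambda>t. (D 1 (m + t) - D 1 (m - t)) / 3
      - t / 3 * (D 2 (m + t) + D 2 (m - t)) - 20 * C * t ^ 3)"
  define P3 where "P3 = (\<lambda>t. - (t / 3 * (D 3 (m + t) - D 3 (m - t))) - 60 * C * t ^ 2)"
  define P where "P = (\<lambda>n::nat. if n = 0 then P0 else if n = 1 then P1 else if n = 2 then P2 else P3)"
  have plus: "((\<lambda>t. G (m + t)) has_real_derivative y) (at t)"
    if "(G has_real_derivative y) (at (m + t))" for G y t
    using that DERIV_shift[of G y t m] by (simp add: add.commute)
  have minus: "((\<lambda>t. G (m - t)) has_real_derivative - y) (at t)"
    if "(G has_real_derivative y) (at (m - t))" for G y t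
  proof -
    have "((\<lambda>t. m - t) has_real_derivative -1) (at t)"
      by (auto intro!: derivative_eq_intros)
    from DERIV_chain2[OF that this] show ?thesis by simp
  qed
  note Ds = D(1)[THEN plus] D(1)[THEN minus] D(2)[THEN plus] D(2)[THEN minus] D(3)[THEN plus] D(3)[THEN minus]
  have P0: "(P0 has_real_derivative P1 t) (at t)" if "0 \<le> t" "t \<le> k" for t
  proof -
    have Fs: "((\<lambda>t. F (m + t)) has_real_derivative D 0 (m + t)) (at t)"
      "((\<lambda>t. F (m - t)) has_real_derivative - D 0 (m - t)) (at t)"
      using F that k by (intro plus minus; simp)+
    show ?thesis
      unfolding P0_def P1_def
      by (rule Fs Ds derivative_eq_intros numeral_neq_zero refl)+ (simp add: field_simps)
  qed
  have P1: "(P1 has_real_derivative P2 t) (at t)" for t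
    unfolding P1_def P2_def
    by (rule Ds derivative_eq_intros numeral_neq_zero refl)+ (simp add: field_simps)
  have P2: "(P2 has_real_derivative P3 t) (at t)" for t
    unfolding P2_def P3_def
    by (rule Ds derivative_eq_intros numeral_neq_zero refl)+ (simp add: field_simps)
  have "\<exists>t. 0 < t \<and> t < k \<and>
      P 0 k = (\<Sum>n<3. (P n 0 / fact n) * k ^ n) + (P 3 t / fact 3) * k ^ 3"
  proof (rule Maclaurin)
    have "DERIV (P n) t :> P (Suc n) t" if "n < 3" "0 \<le> t" "t \<le> k" for n t
    proof -
      consider "n = 0" | "n = 1" | "n = 2" using \<open>n < 3\<close> by linarith
      then show ?thesis
        by cases (use P0 P1 P2 that in \<open>simp_all add: P_def\<close>)
    qed
    then show "\<forall>n t. n < 3 \<and> 0 \<le> t \<and> t \<le> k \<longrightarrow> DERIV (P n) t :> P (Suc n) t"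
      by blast
  qed (use k in auto)
  moreover have "P 0 k = 0" using k(1) by (simp add: P_def P0_def C_def)
  moreover have "P 0 0 = 0" "P 1 0 = 0" "P 2 0 = 0" by (simp_all add: P_def P0_def P1_def P2_def)
  ultimately obtain t where t: "0 < t" "t < k" "P 3 t = 0"
    using k(1) by (auto simp: eval_nat_numeral)
  obtain \<xi> where \<xi>: "m - t < \<xi>" "\<xi> < m + t" "D 3 (m + t) - D 3 (m - t) = 2 * t * D 4 \<xi>"
    using MVT2[of "m - t" "m + t" "D 3" "D 4"] D(4) t by auto
  have "t ^ 2 * (90 * C + D 4 \<xi>) = 0"
    using t(3) \<xi>(3) by (simp add: P_def P3_def power2_eq_square algebra_simps)
  then have C: "C = - D 4 \<xi> / 90" using t by simp
  have "F (m + k) - F (m - k) = k / 3 * (D 0 (m - k) + 4 * D 0 m + D 0 (m + k)) + C * k ^ 5"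
    using k(1) by (simp add: C_def)
  then have "integral {a..a + h} (D 0) = k / 3 * (D 0 a + 4 * D 0 m + D 0 (a + h)) - k ^ 5 / 90 * D 4 \<xi>"
    unfolding int C k(3,4) by simp
  also have "\<dots> = h / 6 * (D 0 a + 4 * D 0 (a + h / 2) + D 0 (a + h)) - h ^ 5 / 2880 * D 4 \<xi>"
    by (simp add: k_def m_def power_divide)
  finally have "integral {a..a + h} (D 0) =
      h / 6 * (D 0 a + 4 * D 0 (a + h / 2) + D 0 (a + h)) - h ^ 5 / 2880 * D 4 \<xi>" .
  moreover have "\<xi> \<in> {a..a + h}" using \<xi> t k by auto
  ultimately show ?thesis using that by blast
qed

lemma I2_as_corrected_simpson:
  assumes "h > 0"
  shows "I2 R fs Fs a h f =
    h / 6 * (f a + 4 * f (a + h / 2) + f (a + h)) - h ^ 5 / 2880 * Omega R fs Fs a h f"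
proof -
  have "h ^ 5 = h * h ^ 4" by (simp add: eval_nat_numeral)
  then have "h ^ 5 / 2880 * Omega R fs Fs a h f = h / 6 * (Omega R fs Fs a h f * h ^ 4 / 480)"
    by simp
  also have "Omega R fs Fs a h f * h ^ 4 / 480 = f a + 4 * f (a + h / 2) + f (a + h)
      + 2 * q1 R fs Fs (f a) (f (a + h))
      - 4 * (q1 R fs Fs (f a) (f (a + h / 2)) + q1 R fs Fs (f (a + h / 2)) (f (a + h)))"
    using assms by (simp add: Omega_def)
  finally have eq: "h ^ 5 / 2880 * Omega R fs Fs a h f = h / 6 * (f a + 4 * f (a + h / 2) + f (a + h)
      + 2 * q1 R fs Fs (f a) (f (a + h))
      - 4 * (q1 R fs Fs (f a) (f (a + h / 2)) + q1 R fs Fs (f (a + h / 2)) (f (a + h))))" .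
  show ?thesis unfolding I2_eq eq unfolding q2_def by (simp add: algebra_simps)
qed

section \<open>Iterated directional derivatives\<close>

definition dir_deriv :: "'a::real_normed_vector \<Rightarrow> ('a \<Rightarrow> 'b::real_normed_vector) \<Rightarrow> 'a \<Rightarrow> 'b" where
  "dir_deriv v g x = frechet_derivative g (at x) v"

lemma Ck_on_Suc_dir_deriv:
  "Ck_on (Suc k) g S \<longleftrightarrow> (\<forall>x\<in>S. g differentiable (at x)) \<and> (\<forall>v. Ck_on k (dir_deriv v g) S)"
  by (simp add: dir_deriv_def[abs_def])

lemma Ck_on_SucD: "Ck_on (Suc k) g S \<Longrightarrow> Ck_on k g S"
proof (induction k arbitrary: g)
  case 0
  then show ?case
    by (auto intro!: continuous_at_imp_continuous_on differentiable_imp_continuous_within)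
next
  case (Suc k)
  then show ?case by (subst Ck_on_Suc_dir_deriv, subst (asm) Ck_on_Suc_dir_deriv) blast
qed

lemma Ck_on_mono:
  assumes "Ck_on k g S" "j \<le> k"
  shows "Ck_on j g S"
  using assms(2)
proof (induction rule: inc_induct)
  case base
  show ?case by (rule assms(1))
next
  case (step n)
  from step.IH show ?case by (rule Ck_on_SucD)
qed

lemma Ck_on_dir_deriv_funpow: "Ck_on (j + k) g S \<Longrightarrow> Ck_on k ((dir_deriv v ^^ j) g) S"
proof (induction j arbitrary: g)
  case (Suc j)
  then have "Ck_on (j + k) (dir_deriv v g) S"
    unfolding add_Suc Ck_on_Suc_dir_deriv by blast
  from Suc.IH[OF this] show ?case by (simp add: funpow_swap1)
qed simp

lemma dir_deriv_eq_deriv: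
  fixes f :: "real \<Rightarrow> real"
  assumes "f differentiable (at x)"
  shows "dir_deriv 1 f x = deriv f x"
proof -
  obtain d where "(f has_real_derivative d) (at x)"
    using assms by (auto simp: real_differentiable_def)
  moreover from this have "frechet_derivative f (at x) = (*) d"
    unfolding has_field_derivative_def by (rule frechet_derivative_at[symmetric])
  ultimately show ?thesis by (simp add: dir_deriv_def DERIV_imp_deriv)
qed

lemma Ck_on_deriv_funpow:
  fixes f :: "real \<Rightarrow> real"
  shows "Ck_on (j + k) f UNIV \<Longrightarrow> Ck_on k ((deriv ^^ j) f) UNIV"
proof (induction j arbitrary: f)
  case (Suc j)
  then have "dir_deriv 1 f = deriv f" and "Ck_on (j + k) (dir_deriv 1 f) UNIV"
    unfolding add_Suc Ck_on_Suc_dir_deriv by (auto simp: dir_deriv_eq_deriv)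
  then have "Ck_on (j + k) (deriv f) UNIV" by simp
  from Suc.IH[OF this] show ?case by (simp add: funpow_swap1)
qed simp

lemma Ck_on_has_real_derivative:
  fixes f :: "real \<Rightarrow> real"
  assumes "Ck_on k f UNIV" "n < k"
  shows "((deriv ^^ n) f has_real_derivative (deriv ^^ Suc n) f x) (at x)"
proof -
  have "Ck_on (Suc (k - Suc n)) ((deriv ^^ n) f) UNIV"
    using assms by (intro Ck_on_deriv_funpow) simp
  then have "(deriv ^^ n) f differentiable (at x)" by simp
  then show ?thesis
    by (auto simp: real_differentiable_def DERIV_imp_deriv)
qed

lemma Ck_on_continuous_deriv:
  fixes f :: "real \<Rightarrow> real"
  assumes "Ck_on k f UNIV" "n \<le> k"
  shows "continuous_on T ((deriv ^^ n) f)"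
proof -
  have "Ck_on 0 ((deriv ^^ n) f) UNIV"
    using Ck_on_mono[OF assms] by (intro Ck_on_deriv_funpow) simp
  then show ?thesis by (auto intro: continuous_on_subset)
qed

text \<open>
  The sum rule holds for \<open>dir_deriv v\<close> only at points where the functions are differentiable, here the
  points of \<open>S\<close>. It can still be iterated, because derivatives at points of an open set depend only on
  the values in that set.
\<close>

lemma dir_deriv_cong_open:
  assumes "open S" "x \<in> S" "\<And>y. y \<in> S \<Longrightarrow> g y = h y"
  shows "dir_deriv v g x = dir_deriv v h x"
proof -
  have "(g has_derivative f') (at x) \<longleftrightarrow> (h has_derivative f') (at x)" for f'
    using has_derivative_transform_within_open[of g f' x UNIV S h]
      has_derivative_transform_within_open[of h f' x UNIV S g] assms by auto
  then show ?thesis by (simp add: dir_deriv_def frechet_derivative_def)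
qed

lemma dir_deriv_funpow_cong_open:
  assumes "open S" "\<And>y. y \<in> S \<Longrightarrow> g y = h y" "x \<in> S"
  shows "(dir_deriv v ^^ k) g x = (dir_deriv v ^^ k) h x"
  using assms(3)
proof (induction k arbitrary: x)
  case (Suc k)
  then show ?case using dir_deriv_cong_open[OF assms(1) Suc.prems Suc.IH] by simp
qed (use assms in simp)

lemma dir_deriv_funpow_linear:
  fixes g h :: "'a::real_normed_vector \<Rightarrow> real"
  assumes "open S" "Ck_on k g S" "Ck_on k h S" "x \<in> S"
  shows "(dir_deriv v ^^ k) (\<lambda>y. a * g y + b * h y) x = a * (dir_deriv v ^^ k) g x + b * (dir_deriv v ^^ k) h x"
  using assms(2-4)
proof (induction k arbitrary: g h x)
  case (Suc k)
  note ck = Suc.prems(1,2)[unfolded Ck_on_Suc_dir_deriv]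
  have step: "dir_deriv v (\<lambda>y. a * g y + b * h y) y = a * dir_deriv v g y + b * dir_deriv v h y" if "y \<in> S" for y
  proof -
    have "((\<lambda>y. a * g y + b * h y) has_derivative
        (\<lambda>w. a * frechet_derivative g (at y) w + b * frechet_derivative h (at y) w)) (at y)"
      using ck that by (auto intro!: derivative_eq_intros simp: frechet_derivative_works[symmetric])
    from frechet_derivative_at[OF this, symmetric] show ?thesis by (simp add: dir_deriv_def)
  qed
  have "(dir_deriv v ^^ Suc k) (\<lambda>y. a * g y + b * h y) x
      = (dir_deriv v ^^ k) (\<lambda>y. a * dir_deriv v g y + b * dir_deriv v h y) x"
    using dir_deriv_funpow_cong_open[OF assms(1) step Suc.prems(3)] by (simp add: funpow_swap1)
  also have "\<dots> = a * (dir_deriv v ^^ k) (dir_deriv v g) x + b * (dir_deriv v ^^ k) (dir_deriv v h) x"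
    using ck Suc.prems(3) by (intro Suc.IH) auto
  finally show ?case by (simp add: funpow_swap1)
qed simp

section \<open>Taylor's theorem in two variables\<close>

text \<open>
  Since \<open>dir_deriv (s, t)\<close> is \<open>s\<close> times the first plus \<open>t\<close> times the second partial derivative, its
  \<open>k\<close>-th iterate is a form of degree \<open>k\<close> in \<open>(s, t)\<close>. The coefficient of \<open>s ^ i * t ^ (k - i)\<close> is the
  sum, over all orders of differentiation, of the partial derivatives of type \<open>(i, k - i)\<close>.
\<close>

lemma dir_deriv_funpow_homogeneous:
  fixes g :: "real \<times> real \<Rightarrow> real"
  assumes "open S" "Ck_on k g S"
  shows "\<exists>c. (\<forall>i\<le>k. continuous_on S (c i)) \<and>
    (\<forall>s t. \<forall>x\<in>S. (dir_deriv (s, t) ^^ k) g x = (\<Sum>i\<le>k. c i x * s ^ i * t ^ (k - i)))"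
  using assms(2)
proof (induction k arbitrary: g)
  case 0
  then show ?case by (intro exI[of _ "\<lambda>_. g"]) simp
next
  case (Suc k)
  note ck = Suc.prems[unfolded Ck_on_Suc_dir_deriv]
  obtain c where c: "\<And>i. i \<le> k \<Longrightarrow> continuous_on S (c i)"
    "\<And>s t x. x \<in> S \<Longrightarrow> (dir_deriv (s, t) ^^ k) (dir_deriv (1, 0) g) x = (\<Sum>i\<le>k. c i x * s ^ i * t ^ (k - i))"
    using Suc.IH[of "dir_deriv (1, 0) g"] ck by blast
  obtain d where d: "\<And>i. i \<le> k \<Longrightarrow> continuous_on S (d i)"
    "\<And>s t x. x \<in> S \<Longrightarrow> (dir_deriv (s, t) ^^ k) (dir_deriv (0, 1) g) x = (\<Sum>i\<le>k. d i x * s ^ i * t ^ (k - i))"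
    using Suc.IH[of "dir_deriv (0, 1) g"] ck by blast
  define e where "e = (\<lambda>i x. (if i = 0 then 0 else c (i - 1) x) + (if i \<le> k then d i x else 0))"
  have "continuous_on S (e i)" if "i \<le> Suc k" for i
  proof -
    have "continuous_on S (\<lambda>x. if i = 0 then 0 else c (i - 1) x)"
      using c(1)[of "i - 1"] that by (cases i) auto
    moreover have "continuous_on S (\<lambda>x. if i \<le> k then d i x else 0)"
      using d(1)[of i] by (cases "i \<le> k") simp_all
    ultimately show ?thesis unfolding e_def by (rule continuous_on_add)
  qed
  moreover have "(dir_deriv (s, t) ^^ Suc k) g x = (\<Sum>i\<le>Suc k. e i x * s ^ i * t ^ (Suc k - i))"
    if x: "x \<in> S" for s t x
  proof -
    have step: "dir_deriv (s, t) g y = s * dir_deriv (1, 0) g y + t * dir_deriv (0, 1) g y" if "y \<in> S" for y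
    proof -
      interpret linear "frechet_derivative g (at y)"
        using ck that linear_frechet_derivative by blast
      have "(s, t) = s *\<^sub>R (1, 0) + t *\<^sub>R (0, 1)" by simp
      then show ?thesis unfolding dir_deriv_def by (metis add scale real_scaleR_def)
    qed
    have 1: "(\<Sum>i\<le>Suc k. (if i = 0 then 0 else c (i - 1) x) * s ^ i * t ^ (Suc k - i))
        = s * (\<Sum>i\<le>k. c i x * s ^ i * t ^ (k - i))"
      unfolding sum.atMost_Suc_shift sum_distrib_left by (simp add: mult_ac)
    have 2: "(\<Sum>i\<le>Suc k. (if i \<le> k then d i x else 0) * s ^ i * t ^ (Suc k - i))
        = t * (\<Sum>i\<le>k. d i x * s ^ i * t ^ (k - i))"
      by (simp add: sum_distrib_left Suc_diff_le mult_ac)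
    have "(dir_deriv (s, t) ^^ Suc k) g x
        = (dir_deriv (s, t) ^^ k) (\<lambda>y. s * dir_deriv (1, 0) g y + t * dir_deriv (0, 1) g y) x"
      using dir_deriv_funpow_cong_open[OF assms(1) step x] by (simp add: funpow_swap1)
    also have "\<dots> = s * (\<Sum>i\<le>k. c i x * s ^ i * t ^ (k - i)) + t * (\<Sum>i\<le>k. d i x * s ^ i * t ^ (k - i))"
      using dir_deriv_funpow_linear[OF assms(1) _ _ x] ck c(2)[OF x] d(2)[OF x] by simp
    also have "\<dots> = (\<Sum>i\<le>Suc k. e i x * s ^ i * t ^ (Suc k - i))"
      unfolding 1[symmetric] 2[symmetric] sum.distrib[symmetric] e_def
      by (rule sum.cong) (simp_all add: algebra_simps)
    finally show ?thesis .
  qed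
  ultimately show ?case by blast
qed

lemma taylor_along_segment:
  fixes g :: "'a::real_normed_vector \<Rightarrow> real"
  assumes "Ck_on n g S" "0 < n" and seg: "\<And>\<tau>. 0 \<le> \<tau> \<Longrightarrow> \<tau> \<le> 1 \<Longrightarrow> z + \<tau> *\<^sub>R v \<in> S"
  obtains \<tau> where "0 < \<tau>" "\<tau> < 1"
    "g (z + v) = (\<Sum>m<n. (dir_deriv v ^^ m) g z / fact m) + (dir_deriv v ^^ n) g (z + \<tau> *\<^sub>R v) / fact n"
proof -
  define p where "p = (\<lambda>m \<tau>. (dir_deriv v ^^ m) g (z + \<tau> *\<^sub>R v))"
  have der: "(p m has_real_derivative p (Suc m) \<tau>) (at \<tau>)" if "m < n" "0 \<le> \<tau>" "\<tau> \<le> 1" for m \<tau>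
  proof -
    let ?G = "(dir_deriv v ^^ m) g" and ?y = "z + \<tau> *\<^sub>R v"
    have "Ck_on (Suc (n - Suc m)) ?G S"
      using assms(1) that by (intro Ck_on_dir_deriv_funpow) simp
    then have G: "(?G has_derivative frechet_derivative ?G (at ?y)) (at ?y)"
      using seg that by (simp add: frechet_derivative_works)
    have "((\<lambda>\<tau>. z + \<tau> *\<^sub>R v) has_derivative (\<lambda>s. s *\<^sub>R v)) (at \<tau>)"
      by (auto intro!: derivative_eq_intros)
    from has_derivative_compose[OF this G]
    have "(p m has_derivative (\<lambda>s. frechet_derivative ?G (at ?y) (s *\<^sub>R v))) (at \<tau>)"
      by (simp add: p_def)
    moreover have "frechet_derivative ?G (at ?y) (s *\<^sub>R v) = p (Suc m) \<tau> * s" for s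
      using linear_cmul[OF has_derivative_linear[OF G], of s v] by (simp add: p_def dir_deriv_def)
    ultimately show ?thesis
      by (simp add: has_field_derivative_def)
  qed
  have "\<exists>\<tau>. 0 < \<tau> \<and> \<tau> < 1 \<and>
      p 0 1 = (\<Sum>m<n. (p m 0 / fact m) * 1 ^ m) + (p n \<tau> / fact n) * 1 ^ n"
    using der \<open>0 < n\<close> by (intro Maclaurin) auto
  then show ?thesis using that by (auto simp: p_def)
qed

text \<open>
  The Lagrange remainder along the segment is a form of degree \<open>k\<close> in \<open>(s, t)\<close> whose coefficients are
  continuous, hence bounded on a closed disc around the base point.
\<close>

lemma taylor_two_variables:
  fixes g :: "real \<times> real \<Rightarrow> real"
  assumes "open S" "Ck_on k g S" "0 < k" "(u, w) \<in> S"
  obtains c C r where "r > 0"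
    "\<And>s t. \<bar>s\<bar> < r \<Longrightarrow> \<bar>t\<bar> < r \<Longrightarrow>
       \<bar>g (u + s, w + t) - (\<Sum>m<k. \<Sum>i\<le>m. c m i * s ^ i * t ^ (m - i))\<bar> \<le> C * (\<bar>s\<bar> + \<bar>t\<bar>) ^ k"
proof -
  let ?z = "(u, w)"
  have "\<forall>m\<in>{..k}. \<exists>c. (\<forall>i\<le>m. continuous_on S (c i)) \<and>
    (\<forall>s t. \<forall>x\<in>S. (dir_deriv (s, t) ^^ m) g x = (\<Sum>i\<le>m. c i x * s ^ i * t ^ (m - i)))"
    using dir_deriv_funpow_homogeneous[OF assms(1) Ck_on_mono[OF assms(2)]] by simp
  from bchoice[OF this] obtain c where all: "\<forall>m\<in>{..k}. (\<forall>i\<le>m. continuous_on S (c m i)) \<and>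
      (\<forall>s t. \<forall>x\<in>S. (dir_deriv (s, t) ^^ m) g x = (\<Sum>i\<le>m. c m i x * s ^ i * t ^ (m - i)))" ..
  have cont: "continuous_on S (c m i)" if "m \<le> k" "i \<le> m" for m i
    using all that by blast
  have c: "(dir_deriv (s, t) ^^ m) g x = (\<Sum>i\<le>m. c m i x * s ^ i * t ^ (m - i))"
    if "m \<le> k" "x \<in> S" for m s t x
    using all that by blast
  obtain \<rho> where \<rho>: "\<rho> > 0" "cball ?z \<rho> \<subseteq> S"
    using assms(1,4) open_contains_cball by blast
  have "\<forall>i\<in>{..k}. \<exists>M. \<forall>x\<in>cball ?z \<rho>. \<bar>c k i x\<bar> \<le> M"
  proof
    fix i assume "i \<in> {..k}"
    then have "i \<le> k" by simp
    have "compact (c k i ` cball ?z \<rho>)"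
      by (intro compact_continuous_image continuous_on_subset[OF cont[OF order_refl \<open>i \<le> k\<close>] \<rho>(2)]
          compact_cball)
    from compact_imp_bounded[OF this] show "\<exists>M. \<forall>x\<in>cball ?z \<rho>. \<bar>c k i x\<bar> \<le> M"
      by (simp add: bounded_iff)
  qed
  from bchoice[OF this] obtain M where "\<forall>i\<in>{..k}. \<forall>x\<in>cball ?z \<rho>. \<bar>c k i x\<bar> \<le> M i" ..
  then have M: "\<bar>c k i x\<bar> \<le> M i" if "i \<le> k" "x \<in> cball ?z \<rho>" for i x
    using that by blast
  define C where "C = (\<Sum>i\<le>k. M i) / fact k"
  define d where "d = (\<lambda>m i. c m i ?z / fact m)"
  show ?thesis
    \<comment> \<open>Half the radius, since the Euclidean norm of \<open>(s, t)\<close> is bounded by \<open>\<bar>s\<bar> + \<bar>t\<bar>\<close>.\<close>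
  proof (rule that[of "\<rho> / 2" d C])
    fix s t assume st: "\<bar>s\<bar> < \<rho> / 2" "\<bar>t\<bar> < \<rho> / 2"
    have ball: "?z + \<tau> *\<^sub>R (s, t) \<in> cball ?z \<rho>" if "0 \<le> \<tau>" "\<tau> \<le> 1" for \<tau>
    proof -
      have "norm (\<tau> *\<^sub>R (s, t)) \<le> norm (s, t)"
        unfolding norm_scaleR using that by (simp add: mult_left_le_one_le)
      also have "\<dots> \<le> \<bar>s\<bar> + \<bar>t\<bar>"
        using norm_Pair_le[of s t] by simp
      finally have "norm (\<tau> *\<^sub>R (s, t)) \<le> \<rho>" using st by simp
      then show ?thesis
        unfolding mem_cball dist_norm by (subst norm_minus_commute) simp
    qed
    obtain \<tau> where \<tau>: "0 < \<tau>" "\<tau> < 1" and eq: "g (?z + (s, t)) =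
        (\<Sum>m<k. (dir_deriv (s, t) ^^ m) g ?z / fact m) + (dir_deriv (s, t) ^^ k) g (?z + \<tau> *\<^sub>R (s, t)) / fact k"
      using taylor_along_segment[OF assms(2,3), of ?z "(s, t)"] ball \<rho>(2) by blast
    let ?y = "?z + \<tau> *\<^sub>R (s, t)"
    have y: "?y \<in> cball ?z \<rho>" using ball \<tau> by simp
    have "g (u + s, w + t) - (\<Sum>m<k. \<Sum>i\<le>m. d m i * s ^ i * t ^ (m - i))
        = (\<Sum>i\<le>k. c k i ?y * s ^ i * t ^ (k - i)) / fact k"
      using eq c[OF order_refl, of ?y s t] y \<rho>(2) c[of _ ?z s t] assms(4)
      by (simp add: d_def sum_divide_distrib subset_iff)
    also have "\<bar>\<dots>\<bar> \<le> (\<Sum>i\<le>k. M i * (\<bar>s\<bar> + \<bar>t\<bar>) ^ k) / fact k"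
    proof -
      have "\<bar>c k i ?y * s ^ i * t ^ (k - i)\<bar> \<le> M i * (\<bar>s\<bar> + \<bar>t\<bar>) ^ k" if "i \<le> k" for i
      proof -
        have "\<bar>s\<bar> ^ i * \<bar>t\<bar> ^ (k - i) \<le> (\<bar>s\<bar> + \<bar>t\<bar>) ^ i * (\<bar>s\<bar> + \<bar>t\<bar>) ^ (k - i)"
          by (intro mult_mono power_mono) auto
        also have "\<dots> = (\<bar>s\<bar> + \<bar>t\<bar>) ^ k"
          using that by (simp flip: power_add)
        finally have "\<bar>c k i ?y\<bar> * (\<bar>s\<bar> ^ i * \<bar>t\<bar> ^ (k - i)) \<le> M i * (\<bar>s\<bar> + \<bar>t\<bar>) ^ k"
          using M[OF that y] by (intro mult_mono) (auto intro: order_trans[OF abs_ge_zero])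
        then show ?thesis by (simp add: abs_mult power_abs mult.assoc)
      qed
      then show ?thesis
        by (auto intro!: divide_right_mono order_trans[OF sum_abs] sum_mono)
    qed
    also have "\<dots> = C * (\<bar>s\<bar> + \<bar>t\<bar>) ^ k"
      by (simp add: C_def sum_distrib_right)
    finally show "\<bar>g (u + s, w + t) - (\<Sum>m<k. \<Sum>i\<le>m. d m i * s ^ i * t ^ (m - i))\<bar> \<le> C * (\<bar>s\<bar> + \<bar>t\<bar>) ^ k" .
  qed (use \<rho> in simp)
qed

section \<open>Expansion of a symmetric mean\<close>

text \<open>
  In the limit \<open>s \<rightarrow> 0\<close> the constant coefficient vanishes; dividing by \<open>s\<close> lowers the degree.
\<close>

lemma polynomial_small_at_zero_imp_zero:
  fixes r :: real and a :: "nat \<Rightarrow> real" and K :: real and i n :: nat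
  assumes "r > 0" and "\<And>s. 0 < s \<Longrightarrow> s < r \<Longrightarrow> \<bar>\<Sum>i<n. a i * s ^ i\<bar> \<le> K * s ^ n" and "i < n"
  shows "a i = 0"
  using assms(2,3)
proof (induction n arbitrary: a i)
  case (Suc n)
  have lim: "((\<lambda>s. \<Sum>i<Suc n. a i * s ^ i) \<longlongrightarrow> (\<Sum>i<Suc n. a i * 0 ^ i)) (at_right 0)"
    by (intro tendsto_intros)
  have sum0: "(\<Sum>i<Suc n. a i * 0 ^ i) = a 0"
    by (simp add: sum.lessThan_Suc_shift del: sum.lessThan_Suc)
  have ev: "\<forall>\<^sub>F s in at_right 0. 0 < s \<and> s < r"
    unfolding eventually_at_right_field using \<open>r > 0\<close> by blast
  have "\<bar>a 0\<bar> \<le> K * 0 ^ Suc n"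
  proof (rule tendsto_le[OF _ _ tendsto_rabs[OF lim[unfolded sum0]]])
    show "((\<lambda>s. K * s ^ Suc n) \<longlongrightarrow> K * 0 ^ Suc n) (at_right 0)"
      by (intro tendsto_intros)
    show "\<forall>\<^sub>F s in at_right 0. \<bar>\<Sum>i<Suc n. a i * s ^ i\<bar> \<le> K * s ^ Suc n"
      using ev by eventually_elim (use Suc.prems(1) in blast)
  qed simp
  then have a0: "a 0 = 0" by simp
  have "\<bar>\<Sum>i<n. a (Suc i) * s ^ i\<bar> \<le> K * s ^ n" if s: "0 < s" "s < r" for s
  proof -
    have "(\<Sum>i<Suc n. a i * s ^ i) = s * (\<Sum>i<n. a (Suc i) * s ^ i)"
      unfolding sum.lessThan_Suc_shift by (simp add: a0 sum_distrib_left mult_ac)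
    then have "s * \<bar>\<Sum>i<n. a (Suc i) * s ^ i\<bar> \<le> s * (K * s ^ n)"
      using Suc.prems(1)[OF s] s by (simp add: abs_mult mult_ac)
    then show ?thesis using s by simp
  qed
  from Suc.IH[OF this] have "a (Suc j) = 0" if "j < n" for j using that by blast
  then show ?case using a0 Suc.prems(2) by (cases i) auto
qed simp

text \<open>
  Averaging the Taylor polynomial \<open>T s t\<close> with \<open>T t s\<close> makes its coefficients symmetric. On the
  diagonal, the resulting polynomial agrees with \<open>u + s\<close> up to fourth order, hence identically, which
  leaves one free coefficient in degree two and one in degree three.
\<close>

lemma symmetric_mean_expansion:
  fixes g :: "real \<Rightarrow> real \<Rightarrow> real"
  assumes "open R" "Ck_on 4 (\<lambda>(x, y). g x y) (R \<times> R)" "u \<in> R"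
    and sym: "\<And>x y. g x y = g y x" and diag: "\<And>x. x \<in> R \<Longrightarrow> g x x = x"
  obtains A B C r where "r > 0"
    "\<And>s t. \<bar>s\<bar> < r \<Longrightarrow> \<bar>t\<bar> < r \<Longrightarrow>
      \<bar>g (u + s) (u + t) - (u + (s + t) / 2 + (s - t)\<^sup>2 * (A + B * (s + t)))\<bar> \<le> C * (\<bar>s\<bar> + \<bar>t\<bar>) ^ 4"
proof -
  have pos: "(0::nat) < 4" and mem: "(u, u) \<in> R \<times> R" using \<open>u \<in> R\<close> by simp_all
  obtain c C r where "r > 0" and taylor: "\<And>s t. \<bar>s\<bar> < r \<Longrightarrow> \<bar>t\<bar> < r \<Longrightarrow>
      \<bar>(\<lambda>(x, y). g x y) (u + s, u + t) - (\<Sum>m<4. \<Sum>i\<le>m. c m i * s ^ i * t ^ (m - i))\<bar> \<le> C * (\<bar>s\<bar> + \<bar>t\<bar>) ^ 4"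
    by (rule taylor_two_variables[OF open_Times[OF \<open>open R\<close> \<open>open R\<close>] assms(2) pos mem]) (rule that)
  define p where "p = (c 1 0 + c 1 1) / 2"
  define A B where "A = (c 2 0 + c 2 2) / 2" and "B = (c 3 0 + c 3 3) / 2"
  define e where "e = (c 3 1 + c 3 2) / 2"
  define P where "P = (\<lambda>s t. c 0 0 + p * (s + t) + A * (s\<^sup>2 + t\<^sup>2) + c 2 1 * (s * t)
    + B * (s ^ 3 + t ^ 3) + e * (s\<^sup>2 * t + s * t\<^sup>2))"
  have P: "\<bar>g (u + s) (u + t) - P s t\<bar> \<le> C * (\<bar>s\<bar> + \<bar>t\<bar>) ^ 4" if st: "\<bar>s\<bar> < r" "\<bar>t\<bar> < r" for s t
  proof -
    define T where "T = (\<lambda>s t. \<Sum>m<4. \<Sum>i\<le>m. c m i * s ^ i * t ^ (m - i))"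
    have "P s t = (T s t + T t s) / 2"
      unfolding P_def T_def p_def A_def B_def e_def
      by (simp add: numeral_eq_Suc) (simp add: field_simps)
    then have "g (u + s) (u + t) - P s t = ((g (u + s) (u + t) - T s t) + (g (u + t) (u + s) - T t s)) / 2"
      using sym[of "u + t" "u + s"] by (simp add: field_simps)
    then show ?thesis
      using taylor[OF st] taylor[OF st(2,1)] unfolding T_def by (simp add: add.commute)
  qed
  obtain r' where r': "r' > 0" "\<And>x. \<bar>x - u\<bar> < r' \<Longrightarrow> x \<in> R"
    using \<open>open R\<close> \<open>u \<in> R\<close> by (auto simp: open_dist dist_real_def)
  define a where "a = (\<lambda>i::nat. if i = 0 then c 0 0 - u else if i = 1 then 2 * p - 1
    else if i = 2 then 2 * A + c 2 1 else 2 * B + 2 * e)"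
  \<comment> \<open>For \<open>s = t\<close> the error bound \<open>C * (\<bar>s\<bar> + \<bar>t\<bar>) ^ 4\<close> is \<open>16 * C * s ^ 4\<close>.\<close>
  have "a i = 0" if "i < 4" for i
  proof (rule polynomial_small_at_zero_imp_zero[where r = "min r r'" and n = 4 and K = "16 * C"])
    fix s assume s: "0 < s" "s < min r r'"
    have "g (u + s) (u + s) = u + s" using s r'(2)[of "u + s"] by (intro diag) simp
    moreover have "(\<Sum>i<4. a i * s ^ i) = P s s - (u + s)"
      unfolding P_def a_def
      by (simp add: numeral_eq_Suc) (simp add: algebra_simps)
    ultimately show "\<bar>\<Sum>i<4. a i * s ^ i\<bar> \<le> 16 * C * s ^ 4"
      using P[of s s] s by (simp add: abs_minus_commute power_mult_distrib flip: mult_2)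
  qed (use \<open>r > 0\<close> r'(1) that in auto)
  from this[of 0] this[of 1] this[of 2] this[of 3]
  have coeffs: "c 0 0 = u" "p = 1 / 2" "c 2 1 = - 2 * A" "e = - B"
    by (simp_all add: a_def)
  have "P s t = u + (s + t) / 2 + (s - t)\<^sup>2 * (A + B * (s + t))" for s t
    unfolding P_def coeffs by (simp add: power2_eq_square power3_eq_cube algebra_simps)
  then show ?thesis using that[of r A B C] P \<open>r > 0\<close> by simp
qed

section \<open>Boundedness of the correction term\<close>

lemma taylor2_bigo:
  fixes f :: "real \<Rightarrow> real"
  assumes "Ck_on 2 f UNIV" "c > 0"
  shows "(\<lambda>h. f (a + c * h) - f a - c * h * deriv f a) \<in> O[at_right 0](\<lambda>h. h\<^sup>2)"
proof -
  have "continuous_on {a..a + c} ((deriv ^^ 2) f)"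
    using assms(1) by (rule Ck_on_continuous_deriv) simp
  from compact_imp_bounded[OF compact_continuous_image[OF this compact_Icc]]
  have "\<exists>M. \<forall>x\<in>{a..a + c}. \<bar>(deriv ^^ 2) f x\<bar> \<le> M"
    by (simp add: bounded_iff)
  then obtain M where M: "\<forall>x\<in>{a..a + c}. \<bar>(deriv ^^ 2) f x\<bar> \<le> M" ..
  have bound: "\<bar>f (a + c * h) - f a - c * h * deriv f a\<bar> \<le> (M * c\<^sup>2 / 2) * h\<^sup>2" if h: "0 < h" "h < 1" for h
  proof -
    have "\<exists>t. 0 < t \<and> t < c * h \<and> f (a + c * h) =
      (\<Sum>m<2. (deriv ^^ m) f (a + 0) / fact m * (c * h) ^ m) + (deriv ^^ 2) f (a + t) / fact 2 * (c * h)\<^sup>2"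
    proof (rule Maclaurin)
      show "\<forall>m t. m < 2 \<and> 0 \<le> t \<and> t \<le> c * h \<longrightarrow>
          ((\<lambda>t. (deriv ^^ m) f (a + t)) has_real_derivative (deriv ^^ Suc m) f (a + t)) (at t)"
      proof (intro allI impI)
        fix m :: nat and t assume "m < 2 \<and> 0 \<le> t \<and> t \<le> c * h"
        then show "((\<lambda>t. (deriv ^^ m) f (a + t)) has_real_derivative (deriv ^^ Suc m) f (a + t)) (at t)"
          using Ck_on_has_real_derivative[OF assms(1), of m "a + t"] DERIV_shift[of "(deriv ^^ m) f" _ t a]
          by (simp add: add.commute)
      qed
    qed (use h assms in auto)
    then obtain t where t: "0 < t" "t < c * h"
      "f (a + c * h) - f a - c * h * deriv f a = (deriv ^^ 2) f (a + t) / 2 * (c * h)\<^sup>2"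
      by (auto simp: numeral_2_eq_2)
    moreover have "c * h < c * 1" using h assms by (intro mult_strict_left_mono) auto
    ultimately have "\<bar>(deriv ^^ 2) f (a + t)\<bar> \<le> M" by (intro bspec[OF M]) auto
    then have "\<bar>(deriv ^^ 2) f (a + t)\<bar> / 2 * (c * h)\<^sup>2 \<le> M / 2 * (c * h)\<^sup>2"
      by (intro mult_right_mono) auto
    then show ?thesis unfolding t(3) by (simp add: abs_mult power_mult_distrib mult_ac)
  qed
  show ?thesis
  proof (rule bigoI[of _ "M * c\<^sup>2 / 2"])
    have "\<forall>\<^sub>F h in at_right (0::real). 0 < h \<and> h < 1"
      unfolding eventually_at_right_field by (intro exI[of _ 1]) auto
    then show "\<forall>\<^sub>F h in at_right 0. norm (f (a + c * h) - f a - c * h * deriv f a) \<le> M * c\<^sup>2 / 2 * norm (h\<^sup>2)"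
      by eventually_elim (use bound in simp)
  qed
qed

text \<open>
  The combination of \<open>f\<close> and \<open>g\<close> is six times the difference between Simpson's rule and the
  three-point rule built from \<open>g\<close>, both taken per unit length. Setting \<open>s2 = 2 * s1 + d\<close> in the
  expansion of \<open>g\<close>, the pure powers of \<open>s1\<close> cancel.
\<close>

lemma mean_defect_bigo:
  fixes g :: "real \<Rightarrow> real \<Rightarrow> real" and f :: "real \<Rightarrow> real"
  assumes "open R" "Ck_on 4 (\<lambda>(x, y). g x y) (R \<times> R)"
    and sym: "\<And>x y. g x y = g y x" and diag: "\<And>x. x \<in> R \<Longrightarrow> g x x = x"
    and f: "Ck_on 2 f UNIV" "f a \<in> R"
  shows "(\<lambda>h. f a + 4 * f (a + h / 2) + f (a + h) + 2 * g (f a) (f (a + h))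
      - 4 * (g (f a) (f (a + h / 2)) + g (f (a + h / 2)) (f (a + h)))) \<in> O[at_right 0](\<lambda>h. h ^ 4)"
proof -
  define u where "u = f a"
  have "u \<in> R" using f(2) by (simp add: u_def)
  obtain A B C r where "r > 0" and E: "\<And>s t. \<bar>s\<bar> < r \<Longrightarrow> \<bar>t\<bar> < r \<Longrightarrow>
      \<bar>g (u + s) (u + t) - (u + (s + t) / 2 + (s - t)\<^sup>2 * (A + B * (s + t)))\<bar> \<le> C * (\<bar>s\<bar> + \<bar>t\<bar>) ^ 4"
    by (rule symmetric_mean_expansion[OF assms(1,2) \<open>u \<in> R\<close> sym diag]) (assumption, rule that)
  define s1 where "s1 = (\<lambda>h. f (a + h / 2) - u)"
  define s2 where "s2 = (\<lambda>h. f (a + h) - u)"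
  define d where "d = (\<lambda>h. s2 h - 2 * s1 h)"
  define R4 where "R4 = (\<lambda>s t. g (u + s) (u + t) - (u + (s + t) / 2 + (s - t)\<^sup>2 * (A + B * (s + t))))"
  have q1: "(\<lambda>h. s1 h - h / 2 * deriv f a) \<in> O[at_right 0](\<lambda>h. h\<^sup>2)"
    using taylor2_bigo[OF f(1), of "1 / 2" a] by (simp add: s1_def u_def)
  have q2: "(\<lambda>h. s2 h - h * deriv f a) \<in> O[at_right 0](\<lambda>h. h\<^sup>2)"
    using taylor2_bigo[OF f(1), of 1 a] by (simp add: s2_def u_def)
  have "d = (\<lambda>h. (s2 h - h * deriv f a) - ((s1 h - h / 2 * deriv f a) + (s1 h - h / 2 * deriv f a)))"
    by (simp add: d_def fun_eq_iff)
  then have d: "d \<in> O[at_right 0](\<lambda>h. h\<^sup>2)"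
    using sum_in_bigo(2)[OF q2 sum_in_bigo(1)[OF q1 q1]] by (simp only:)
  have ev: "\<forall>\<^sub>F h in at_right (0::real). 0 < h \<and> h < 1"
    unfolding eventually_at_right_field by (intro exI[of _ 1]) auto
  have h21: "(\<lambda>h. h\<^sup>2) \<in> O[at_right 0](\<lambda>h::real. h)"
  proof (rule bigoI[of _ 1])
    show "\<forall>\<^sub>F h in at_right 0. norm (h\<^sup>2) \<le> 1 * norm (h::real)"
      using ev by eventually_elim (simp add: power2_eq_square mult_left_le)
  qed
  have s1: "s1 \<in> O[at_right 0](\<lambda>h. h)"
  proof -
    have "(\<lambda>h. h / 2 * deriv f a) \<in> O[at_right 0](\<lambda>h. h)"
      by simp
    from sum_in_bigo(1)[OF landau_o.big_trans[OF q1 h21] this] show ?thesis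
      by (simp only: diff_add_cancel)
  qed
  have s2: "s2 \<in> O[at_right 0](\<lambda>h. h)"
  proof -
    have "(\<lambda>h. d h + 2 * s1 h) \<in> O[at_right 0](\<lambda>h. h)"
      using landau_o.big_trans[OF d h21] s1 by (intro sum_in_bigo) simp_all
    then show ?thesis by (simp add: d_def)
  qed
  have rem: "(\<lambda>h. R4 (x h) (y h)) \<in> O[at_right 0](\<lambda>h. h ^ 4)"
    if x: "x \<in> O[at_right 0](\<lambda>h. h)" and y: "y \<in> O[at_right 0](\<lambda>h. h)" for x y
  proof -
    have small: "\<forall>\<^sub>F h in at_right 0. \<bar>z h\<bar> < r" if "z \<in> O[at_right 0](\<lambda>h. h)" for z
    proof -
      have "(\<lambda>h::real. h) \<in> o[at_right 0](\<lambda>_. 1)"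
        by (rule smalloI_tendsto) (auto intro: tendsto_ident_at)
      from smalloD_tendsto[OF landau_o.big_small_trans[OF that this]]
      have "(z \<longlongrightarrow> 0) (at_right 0)" by simp
      from tendstoD[OF this \<open>r > 0\<close>] show ?thesis by (simp add: dist_real_def)
    qed
    have "(\<lambda>h. \<bar>x h\<bar> + \<bar>y h\<bar>) \<in> O[at_right 0](\<lambda>h. h)"
      using x y by (intro sum_in_bigo) simp_all
    then have "(\<lambda>h. (\<bar>x h\<bar> + \<bar>y h\<bar>) ^ 4) \<in> O[at_right 0](\<lambda>h. h ^ 4)"
      by (rule landau_o.big_power)
    moreover have "(\<lambda>h. R4 (x h) (y h)) \<in> O[at_right 0](\<lambda>h. (\<bar>x h\<bar> + \<bar>y h\<bar>) ^ 4)"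
    proof (rule bigoI[of _ C])
      show "\<forall>\<^sub>F h in at_right 0. norm (R4 (x h) (y h)) \<le> C * norm ((\<bar>x h\<bar> + \<bar>y h\<bar>) ^ 4)"
        using small[OF x] small[OF y] by eventually_elim (use E in \<open>simp add: R4_def\<close>)
    qed
    ultimately show ?thesis by (rule landau_o.big_trans[rotated])
  qed
  have zero: "(\<lambda>_. 0) \<in> O[at_right 0](\<lambda>h::real. h)" by simp
  \<comment> \<open>The combination, rewritten with the remainders \<open>R4\<close> and \<open>s2 = 2 * s1 + d\<close>.\<close>
  have "(\<lambda>h. 2 * R4 0 (s2 h) - 4 * R4 0 (s1 h) - 4 * R4 (s1 h) (s2 h)
      - 2 * A * (d h)\<^sup>2 - 2 * B * (2 * (d h * (s1 h)\<^sup>2) + (d h)\<^sup>2 * (4 * s1 h + d h)))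
      \<in> O[at_right 0](\<lambda>h. h ^ 4)"
  proof -
    have d2: "(\<lambda>h. (d h)\<^sup>2) \<in> O[at_right 0](\<lambda>h. h ^ 4)"
      using landau_o.big_power[OF d, of 2] by simp
    have "(\<lambda>h. d h * (s1 h)\<^sup>2) \<in> O[at_right 0](\<lambda>h. h\<^sup>2 * h\<^sup>2)"
      by (intro landau_o.big.mult d landau_o.big_power s1)
    then have ds: "(\<lambda>h. 2 * (d h * (s1 h)\<^sup>2)) \<in> O[at_right 0](\<lambda>h. h ^ 4)"
      by (simp flip: power_add)
    have "(\<lambda>h::real. h) \<in> O[at_right 0](\<lambda>h. 1)"
    proof (rule bigoI[of _ 1])
      show "\<forall>\<^sub>F h in at_right 0. norm (h::real) \<le> 1 * norm (1::real)"
        using ev by eventually_elim simp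
    qed
    from landau_o.big_trans[OF s1 this] landau_o.big_trans[OF landau_o.big_trans[OF d h21] this]
    have "(\<lambda>h. 4 * s1 h + d h) \<in> O[at_right 0](\<lambda>h. 1)"
      by (intro sum_in_bigo) simp_all
    from landau_o.big.mult[OF d2 this]
    have dds: "(\<lambda>h. (d h)\<^sup>2 * (4 * s1 h + d h)) \<in> O[at_right 0](\<lambda>h. h ^ 4)" by simp
    show ?thesis
      using rem[OF zero s2] rem[OF zero s1] rem[OF s1 s2] d2 sum_in_bigo(1)[OF ds dds]
      by (intro sum_in_bigo) simp_all
  qed
  also have "(\<lambda>h. 2 * R4 0 (s2 h) - 4 * R4 0 (s1 h) - 4 * R4 (s1 h) (s2 h)
      - 2 * A * (d h)\<^sup>2 - 2 * B * (2 * (d h * (s1 h)\<^sup>2) + (d h)\<^sup>2 * (4 * s1 h + d h))) =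
    (\<lambda>h. f a + 4 * f (a + h / 2) + f (a + h) + 2 * g (f a) (f (a + h))
      - 4 * (g (f a) (f (a + h / 2)) + g (f (a + h / 2)) (f (a + h))))"
  proof
    fix h
    have "f a = u" "f (a + h / 2) = u + s1 h" "f (a + h) = u + s2 h" "s2 h = 2 * s1 h + d h"
      by (simp_all add: u_def s1_def s2_def d_def)
    then show "2 * R4 0 (s2 h) - 4 * R4 0 (s1 h) - 4 * R4 (s1 h) (s2 h)
      - 2 * A * (d h)\<^sup>2 - 2 * B * (2 * (d h * (s1 h)\<^sup>2) + (d h)\<^sup>2 * (4 * s1 h + d h)) =
      f a + 4 * f (a + h / 2) + f (a + h) + 2 * g (f a) (f (a + h))
      - 4 * (g (f a) (f (a + h / 2)) + g (f (a + h / 2)) (f (a + h)))"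
      by (simp add: R4_def) (simp add: power2_eq_square algebra_simps)
  qed
  finally show ?thesis .
qed

lemma Omega_bounded:
  fixes fs Fs f :: "real \<Rightarrow> real" and a :: real
  assumes bij: "bij_betw fs UNIV R"
    and der: "\<And>x. (Fs has_real_derivative fs x) (at x)"
    and q1: "Ck_on 4 (\<lambda>(u, v). q1 R fs Fs u v) (R \<times> R)"
    and f: "Ck_on 2 f UNIV" "f a \<in> R"
  shows "Bfun (\<lambda>h. Omega R fs Fs a h f) (at_right 0)"
proof -
  have "open R"
    using bij der by (rule bijective_derivative_inverse(1))
  define N where "N = (\<lambda>h. f a + 4 * f (a + h / 2) + f (a + h) + 2 * q1 R fs Fs (f a) (f (a + h))
      - 4 * (q1 R fs Fs (f a) (f (a + h / 2)) + q1 R fs Fs (f (a + h / 2)) (f (a + h))))"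
  have "N \<in> O[at_right 0](\<lambda>h. h ^ 4)"
    unfolding N_def
    by (rule mean_defect_bigo[OF \<open>open R\<close> q1 q1_commute q1_diagonal(1)[OF bij der] f]) assumption
  then obtain c where "c > 0" and c: "\<forall>\<^sub>F h in at_right 0. norm (N h) \<le> c * norm (h ^ 4)"
    by (rule landau_o.bigE)
  have "\<forall>\<^sub>F h in at_right 0. norm (Omega R fs Fs a h f) \<le> 480 * c"
    using c eventually_at_right_less
  proof eventually_elim
    case (elim h)
    have "Omega R fs Fs a h f = 480 / h ^ 4 * N h"
      by (simp only: Omega_def N_def)
    then have "norm (Omega R fs Fs a h f) = 480 / h ^ 4 * norm (N h)"
      by (simp add: abs_mult)
    also have "\<dots> \<le> 480 / h ^ 4 * (c * h ^ 4)"
      using elim by (intro mult_left_mono) simp_all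
    also have "\<dots> = 480 * c" using elim by simp
    finally show ?case .
  qed
  then show ?thesis by (rule BfunI)
qed

section \<open>The quadrature theorem\<close>

lemma I2_error_bound:
  fixes f :: "real \<Rightarrow> real" and a h :: real
  assumes f: "Ck_on 4 f UNIV" and "h > 0"
  shows "\<bar>I2 R fs Fs a h f - integral {a..a + h} f\<bar>
    \<le> h ^ 5 / 2880 * (SUP \<xi>\<in>{a..a + h}. \<bar>(deriv ^^ 4) f \<xi> - Omega R fs Fs a h f\<bar>)"
proof -
  let ?e = "\<lambda>\<xi>. \<bar>(deriv ^^ 4) f \<xi> - Omega R fs Fs a h f\<bar>"
  obtain \<xi> where \<xi>: "\<xi> \<in> {a..a + h}" and int: "integral {a..a + h} ((deriv ^^ 0) f)
      = h / 6 * ((deriv ^^ 0) f a + 4 * (deriv ^^ 0) f (a + h / 2) + (deriv ^^ 0) f (a + h))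
        - h ^ 5 / 2880 * (deriv ^^ 4) f \<xi>"
    using simpson_error[of "\<lambda>n. (deriv ^^ n) f", OF Ck_on_has_real_derivative[OF f] \<open>h > 0\<close>] by blast
  have eq: "I2 R fs Fs a h f - integral {a..a + h} f
      = h ^ 5 / 2880 * ((deriv ^^ 4) f \<xi> - Omega R fs Fs a h f)"
    using int unfolding I2_as_corrected_simpson[OF \<open>h > 0\<close>] by (simp add: algebra_simps)
  have "\<bar>I2 R fs Fs a h f - integral {a..a + h} f\<bar> = h ^ 5 / 2880 * ?e \<xi>"
    unfolding eq using \<open>h > 0\<close> by (simp add: abs_mult)
  also have "\<dots> \<le> h ^ 5 / 2880 * (SUP \<xi>\<in>{a..a + h}. ?e \<xi>)"
  proof (rule mult_left_mono[OF cSUP_upper[OF \<xi>]])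
    have "continuous_on {a..a + h} ?e"
      by (intro continuous_intros Ck_on_continuous_deriv[OF f]) simp
    from compact_imp_bounded[OF compact_continuous_image[OF this compact_Icc]]
    show "bdd_above (?e ` {a..a + h})" by (rule bounded_imp_bdd_above)
  qed (use \<open>h > 0\<close> in simp)
  finally show ?thesis .
qed

theorem theorem2:
  fixes R :: "real set" and fs Fs :: "real \<Rightarrow> real"
  assumes bij: "bij_betw fs UNIV R"
    and antideriv: "\<And>x. (Fs has_real_derivative fs x) (at x)"
  shows
    "(\<forall>f0\<in>R. ((\<lambda>y. q1 R fs Fs f0 y) \<longlongrightarrow> q1 R fs Fs f0 f0) (at f0 within R)) \<and>
     symmetric_quadrature R [0, 1] (\<lambda>v. q1 R fs Fs (v ! 0) (v ! 1)) \<and>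
     affinely_exact [0, 1] (\<lambda>v. q1 R fs Fs (v ! 0) (v ! 1)) fs \<and>
     symmetric_quadrature R [0, 1 / 2, 1] (\<lambda>v. q2 R fs Fs (v ! 0) (v ! 1) (v ! 2)) \<and>
     affinely_exact [0, 1 / 2, 1] (\<lambda>v. q2 R fs Fs (v ! 0) (v ! 1) (v ! 2)) fs \<and>
     (\<forall>f :: real \<Rightarrow> real. Ck_on 4 f UNIV \<and> range f \<subseteq> R \<longrightarrow>
        (\<forall>a h. h > 0 \<longrightarrow>
           \<bar>I2 R fs Fs a h f - integral {a..a + h} f\<bar>
             \<le> h ^ 5 / 2880 * (SUP \<xi>\<in>{a..a + h}. \<bar>(deriv ^^ 4) f \<xi> - Omega R fs Fs a h f\<bar>))) \<and>
     (Ck_on 4 (\<lambda>(u, v). q1 R fs Fs u v) (R \<times> R) \<longrightarrow>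
        (\<forall>f :: real \<Rightarrow> real. Ck_on 4 f UNIV \<and> range f \<subseteq> R \<longrightarrow>
           (\<forall>a. Bfun (\<lambda>h. Omega R fs Fs a h f) (at_right 0))))"
proof (intro conjI ballI allI impI; (elim conjE)?)
  show "((\<lambda>y. q1 R fs Fs f0 y) \<longlongrightarrow> q1 R fs Fs f0 f0) (at f0 within R)" if "f0 \<in> R" for f0
    using q1_diagonal[OF bij antideriv that] by simp
  show "symmetric_quadrature R [0, 1] (\<lambda>v. q1 R fs Fs (v ! 0) (v ! 1))"
    unfolding symmetric_quadrature_def
    by (auto simp: less_Suc_eq length_Suc_conv q1_commute)
  show "symmetric_quadrature R [0, 1 / 2, 1] (\<lambda>v. q2 R fs Fs (v ! 0) (v ! 1) (v ! 2))"
    unfolding symmetric_quadrature_def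
  proof (intro conjI allI impI)
    show "q2 R fs Fs (rev v ! 0) (rev v ! 1) (rev v ! 2) = q2 R fs Fs (v ! 0) (v ! 1) (v ! 2)"
      if v: "length v = length [0, 1 / 2, 1 :: real] \<and> set v \<subseteq> R" for v
    proof -
      obtain x y z where "v = [x, y, z]"
        using v by (auto simp: length_Suc_conv)
      then show ?thesis
        using q1_commute[of R fs Fs z y] q1_commute[of R fs Fs y x] q1_commute[of R fs Fs z x]
        by (simp add: q2_def)
    qed
  qed (auto simp: less_Suc_eq)
  show "affinely_exact [0, 1] (\<lambda>v. q1 R fs Fs (v ! 0) (v ! 1)) fs"
    unfolding affinely_exact_def using I1_affinely_exact[OF bij antideriv] by blast
  show "affinely_exact [0, 1 / 2, 1] (\<lambda>v. q2 R fs Fs (v ! 0) (v ! 1) (v ! 2)) fs"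
    unfolding affinely_exact_def using I2_affinely_exact[OF bij antideriv] by blast
  show "\<bar>I2 R fs Fs a h f - integral {a..a + h} f\<bar>
      \<le> h ^ 5 / 2880 * (SUP \<xi>\<in>{a..a + h}. \<bar>(deriv ^^ 4) f \<xi> - Omega R fs Fs a h f\<bar>)"
    if "Ck_on 4 f UNIV" "0 < h" for f a h
    using that by (rule I2_error_bound)
  show "Bfun (\<lambda>h. Omega R fs Fs a h f) (at_right 0)"
    if "Ck_on 4 (\<lambda>(u, v). q1 R fs Fs u v) (R \<times> R)" "Ck_on 4 f UNIV" "range f \<subseteq> R" for f a
  proof (rule Omega_bounded[OF bij antideriv that(1)])
    show "Ck_on 2 f UNIV" using that(2) by (rule Ck_on_mono) simp
    show "f a \<in> R" using that(3) by blast
  qed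
qed

end
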